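(* Let $k\geqslant1$ and let ${\tt w}_k=D^k({\tt f})$ be the word obtained from the Fibonacci word ${\tt f}$ by deleting the first $k$ occurrences of ${\tt a}$ and the first $k$ occurrences of ${\tt b}$. Then there exists $N=N(k)$ such that $r_{{\tt w}_k}(n)=n+k$ for all $n>N$.
   Context: The Fibonacci word ${\tt f}={\tt a}{\tt b}{\tt a}{\tt a}{\tt b}{\tt a}{\tt b}{\tt a}\cdots$ is the fixed point of $\varrho_F:{\tt a}\mapsto{\tt a}{\tt b},\ {\tt b}\mapsto{\tt a}$. $D$ deletes the first ${\tt a}$ and the first ${\tt b}$ of a word. Words are indexed from position $0$; $p_{\tt a}(n)$, $p_{\tt b}(n)$ denote the positions of the $n$-th ${\tt a}$ and $n$-th ${\tt b}$, and $r_{\tt w}(n)=p_{\tt b}(n)-p_{\tt a}(n)$. *)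

theory Defs
  imports Main "HOL-Library.Stream" "HOL-Library.Infinite_Set"
begin

datatype letter = LA | LB

fun fib_subst :: "letter \<Rightarrow> letter list" where
  "fib_subst LA = [LA, LB]"
| "fib_subst LB = [LA]"

definition fib_subst_word :: "letter stream \<Rightarrow> letter stream" where
  "fib_subst_word w = flat (smap fib_subst w)"

definition fib_word :: "letter stream" where
  "fib_word = (THE w. fib_subst_word w = w)"

definition delete_first :: "'a \<Rightarrow> 'a stream \<Rightarrow> 'a stream" where
  "delete_first x w =
     (if x \<in> sset w
      then (let n = (LEAST n. w !! n = x) in stake n w @- sdrop (Suc n) w)
      else w)"

definition del_ab :: "letter stream \<Rightarrow> letter stream" where
  "del_ab w = delete_first LB (delete_first LA w)"

(* Occurrences are counted from 1 (so n = 0 carries no meaning), positions from 0;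
   enumerate lists an infinite set of naturals increasingly, starting at index 0.
   The counting from 1 is the convention under which the difference below equals n
   for the Fibonacci word itself. *)
definition pos :: "'a \<Rightarrow> 'a stream \<Rightarrow> nat \<Rightarrow> nat" where
  "pos x w n = enumerate {i. w !! i = x} (n - 1)"

definition ab_diff :: "letter stream \<Rightarrow> nat \<Rightarrow> int" where
  "ab_diff w n = int (pos LB w n) - int (pos LA w n)"

lemma fib_subst_ne [simp]: "fib_subst x \<noteq> []"
  by (cases x) auto

lemma fib_subst_word_Cons: "fib_subst_word (x ## w) = fib_subst x @- fib_subst_word w"
  by (simp add: fib_subst_word_def)

lemma fib_subst_word_shift:
  "fib_subst_word (xs @- w) = concat (map fib_subst xs) @- fib_subst_word w"
  by (induction xs) (simp_all add: fib_subst_word_Cons)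

definition fib_prefix :: "nat \<Rightarrow> letter list" where
  "fib_prefix n = ((\<lambda>xs. concat (map fib_subst xs)) ^^ n) [LA]"

lemma fib_prefix_0 [simp]: "fib_prefix 0 = [LA]"
  by (simp add: fib_prefix_def)

lemma fib_prefix_Suc: "fib_prefix (Suc n) = concat (map fib_subst (fib_prefix n))"
  by (simp add: fib_prefix_def)

lemma fib_prefix_extends: "\<exists>ys. ys \<noteq> [] \<and> fib_prefix (Suc n) = fib_prefix n @ ys"
proof (induction n)
  case 0
  show ?case by (simp add: fib_prefix_Suc)
next
  case (Suc n)
  then obtain ys where ys: "ys \<noteq> []" "fib_prefix (Suc n) = fib_prefix n @ ys" by blast
  have "fib_prefix (Suc (Suc n)) = fib_prefix (Suc n) @ concat (map fib_subst ys)"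
    by (subst fib_prefix_Suc, subst ys(2), simp add: fib_prefix_Suc)
  moreover have "concat (map fib_subst ys) \<noteq> []"
    using ys(1) by (cases ys) auto
  ultimately show ?case by blast
qed

lemma fib_prefix_le: "m \<le> n \<Longrightarrow> \<exists>ys. fib_prefix n = fib_prefix m @ ys"
proof (induction n rule: dec_induct)
  case base
  show ?case by simp
next
  case (step n)
  then show ?case using fib_prefix_extends[of n] by auto
qed

lemma length_fib_prefix: "n < length (fib_prefix n)"
proof (induction n)
  case 0
  show ?case by simp
next
  case (Suc n)
  obtain ys where "ys \<noteq> []" "fib_prefix (Suc n) = fib_prefix n @ ys"
    using fib_prefix_extends by blast
  then have "length ys > 0" "length (fib_prefix (Suc n)) = length (fib_prefix n) + length ys"
    by simp_all
  then show ?case using Suc by linarith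
qed

lemma stream_eq_fib_prefixI:
  assumes "\<And>n. \<exists>s. v = fib_prefix n @- s" "\<And>n. \<exists>s. w = fib_prefix n @- s"
  shows "v = w"
proof -
  have "v !! i = w !! i" for i
  proof -
    obtain s t where "v = fib_prefix i @- s" "w = fib_prefix i @- t"
      using assms by blast
    then show ?thesis using length_fib_prefix[of i] by simp
  qed
  then have "smap (snth v) nats = smap (snth w) nats" by presburger
  then show ?thesis by (simp flip: stream_smap_nats)
qed

lemma fib_fixed_point_prefix:
  assumes "fib_subst_word w = w"
  shows "\<exists>s. w = fib_prefix n @- s"
proof (induction n)
  case 0
  have "shd (fib_subst_word w) = LA"
    by (cases w; cases "shd w") (auto simp: fib_subst_word_Cons)
  then have "w = [LA] @- stl w" using assms by (cases w) auto
  then show ?case unfolding fib_prefix_0 by blast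
next
  case (Suc n)
  then obtain s where "w = fib_prefix n @- s" by blast
  then have "fib_subst_word w = fib_prefix (Suc n) @- fib_subst_word s"
    by (simp add: fib_subst_word_shift fib_prefix_Suc)
  then show ?case using assms by auto
qed

lemma fib_fixed_point_exists: "\<exists>w. fib_subst_word w = w"
proof -
  define w where "w = smap (\<lambda>i. fib_prefix i ! i) nats"
  have pre: "\<exists>s. w = fib_prefix n @- s" for n
  proof -
    have "stake (length (fib_prefix n)) w = fib_prefix n"
    proof (rule nth_equalityI)
      fix i assume "i < length (stake (length (fib_prefix n)) w)"
      then have i: "i < length (fib_prefix n)" by simp
      have "fib_prefix i ! i = fib_prefix n ! i"
      proof (cases "i \<le> n")
        case True
        then obtain ys where "fib_prefix n = fib_prefix i @ ys" using fib_prefix_le by blast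
        then show ?thesis using length_fib_prefix[of i] by (simp add: nth_append)
      next
        case False
        then obtain ys where "fib_prefix i = fib_prefix n @ ys"
          using fib_prefix_le[of n i] by auto
        then show ?thesis using i by (simp add: nth_append)
      qed
      then show "stake (length (fib_prefix n)) w ! i = fib_prefix n ! i"
        using i by (simp add: w_def)
    qed simp
    then show ?thesis by (metis stake_sdrop)
  qed
  have "\<exists>s. fib_subst_word w = fib_prefix n @- s" for n
  proof -
    obtain s where "w = fib_prefix n @- s" using pre by blast
    then have "fib_subst_word w = fib_prefix (Suc n) @- fib_subst_word s"
      by (simp add: fib_subst_word_shift fib_prefix_Suc)
    moreover obtain ys where "fib_prefix (Suc n) = fib_prefix n @ ys"
      using fib_prefix_extends by blast
    ultimately have "fib_subst_word w = fib_prefix n @- ys @- fib_subst_word s" by simp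
    then show ?thesis by blast
  qed
  then show ?thesis using pre stream_eq_fib_prefixI by blast
qed

lemma fib_fixed_point_unique: "\<exists>!w. fib_subst_word w = w"
  using fib_fixed_point_exists fib_fixed_point_prefix stream_eq_fib_prefixI by metis

lemma fib_word_fixed_point: "fib_subst_word fib_word = fib_word"
  unfolding fib_word_def by (rule theI'[OF fib_fixed_point_unique])

lemma fib_word_prefix: "\<exists>s. fib_word = fib_prefix n @- s"
  by (rule fib_fixed_point_prefix[OF fib_word_fixed_point])

end

theory Submission
  imports Defs
begin

text \<open>
  Since \<open>f\<close> is fixed by the substitution and only the image of \<open>a\<close> contains a \<open>b\<close>, the \<open>n\<close>-th \<open>b\<close> of
  \<open>f\<close> is the last letter of the image of the prefix ending in the \<open>n\<close>-th \<open>a\<close>. That prefix has length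
  \<open>p\<^sub>a(n) + 1\<close> and contains \<open>n\<close> letters \<open>a\<close>, so its image has length \<open>p\<^sub>a(n) + 1 + n\<close>, whence
  \<open>p\<^sub>b(n) = p\<^sub>a(n) + n\<close>. Deleting \<open>k\<close> letters of each kind changes only a finite prefix: beyond it,
  the \<open>n\<close>-th occurrence of either letter is the \<open>(n + k)\<close>-th one of \<open>f\<close>, moved left by \<open>2k\<close>, so
  the difference of positions becomes \<open>n + k\<close>.
\<close>

lemma count_list_stake: "count_list (stake i w) x = card {j. j < i \<and> w !! j = x}"
proof (induction i)
  case (Suc i)
  have "{j. j < Suc i \<and> w !! j = x} =
      (if w !! i = x then insert i {j. j < i \<and> w !! j = x} else {j. j < i \<and> w !! j = x})"
    by (auto simp: less_Suc_eq)
  then show ?case using Suc by (simp add: stake_Suc del: stake.simps)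
qed simp

text \<open>Replaces \<open>enumerate\<close> by counts on prefixes, which can be followed through
  concatenation and substitution: as \<open>enumerate\<close> is strictly increasing, the index of
  \<open>i\<close> is the number of earlier occurrences.\<close>

lemma pos_eqI:
  assumes "w !! i = x" "Suc (count_list (stake i w) x) = n" "infinite {j. w !! j = x}"
  shows "pos x w n = i"
proof -
  let ?S = "{j. w !! j = x}"
  obtain m where m: "enumerate ?S m = i"
    using assms(1,3) enumerate_Ex by fastforce
  have "{j. j < i \<and> w !! j = x} = enumerate ?S ` {..<m}"
  proof (intro equalityI subsetI)
    fix j assume j: "j \<in> {j. j < i \<and> w !! j = x}"
    then obtain l where "enumerate ?S l = j"
      using assms(3) enumerate_Ex by fastforce
    then show "j \<in> enumerate ?S ` {..<m}"
      using j m assms(3) by auto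
  next
    fix j assume "j \<in> enumerate ?S ` {..<m}"
    then show "j \<in> {j. j < i \<and> w !! j = x}"
      using m assms(3) enumerate_in_set[of ?S] by auto
  qed
  moreover have "inj_on (enumerate ?S) {..<m}"
    using assms(3) inj_enumerate inj_on_subset by blast
  ultimately have "count_list (stake i w) x = m"
    by (simp add: count_list_stake card_image)
  then show ?thesis using m assms(2) by (auto simp: pos_def)
qed

lemma pos_properties:
  assumes "infinite {j. w !! j = x}" "n \<ge> 1"
  shows "w !! pos x w n = x" "Suc (count_list (stake (pos x w n) w) x) = n" "n \<le> Suc (pos x w n)"
proof -
  let ?i = "pos x w n"
  show i: "w !! ?i = x"
    using enumerate_in_set[OF assms(1), of "n - 1"] by (simp add: pos_def)
  \<comment> \<open>The prefix count also names an index for \<open>?i\<close>; injectivity of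
    \<open>enumerate\<close> will identify it with \<open>n\<close>.\<close>
  have "pos x w (Suc (count_list (stake ?i w) x)) = ?i"
    using i assms(1) by (intro pos_eqI) auto
  then have "enumerate {j. w !! j = x} (count_list (stake ?i w) x) =
      enumerate {j. w !! j = x} (n - 1)"
    by (simp add: pos_def)
  then have "count_list (stake ?i w) x = n - 1"
    using inj_enumerate[OF assms(1)] by (simp add: inj_eq)
  then show c: "Suc (count_list (stake ?i w) x) = n"
    using assms(2) by simp
  show "n \<le> Suc ?i"
    using count_le_length[of "stake ?i w" x] c by simp
qed

lemma length_fib_subst_concat:
  "length (concat (map fib_subst xs)) = length xs + count_list xs LA"
proof (induction xs)
  case (Cons x xs)
  then show ?case by (cases x) auto
qed simp

lemma count_LB_fib_subst_concat:
  "count_list (concat (map fib_subst xs)) LB = count_list xs LA"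
proof (induction xs)
  case (Cons x xs)
  then show ?case by (cases x) auto
qed simp

lemma fib_word_split:
  "fib_word = concat (map fib_subst (stake i fib_word)) @- fib_subst (fib_word !! i) @-
     fib_subst_word (sdrop (Suc i) fib_word)"
  by (metis fib_subst_word_Cons fib_subst_word_shift fib_word_fixed_point id_stake_snth_sdrop)

text \<open>Every image begins with \<open>LA\<close>, and the image of letter \<open>i\<close>
  starts at this index. As the index is at least \<open>i\<close>, \<open>LA\<close> occurs
  arbitrarily late.\<close>

lemma snth_fib_word_LA: "fib_word !! (i + count_list (stake i fib_word) LA) = LA"
proof -
  have "fib_word !! length (concat (map fib_subst (stake i fib_word))) = LA"
    by (subst fib_word_split[of i], cases "fib_word !! i") simp_all
  then show ?thesis by (simp add: length_fib_subst_concat)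
qed

text \<open>The image of the \<open>LA\<close> at \<open>i\<close> is \<open>[LA, LB]\<close>; the
  \<open>Suc\<close> in \<open>j\<close> steps over its \<open>LA\<close>. Each earlier
  \<open>LA\<close> has contributed exactly one \<open>LB\<close>.\<close>

lemma fib_word_LB_of_LA:
  assumes "fib_word !! i = LA"
  defines "j \<equiv> Suc (i + count_list (stake i fib_word) LA)"
  shows "fib_word !! j = LB" "count_list (stake j fib_word) LB = count_list (stake i fib_word) LA"
proof -
  let ?xs = "concat (map fib_subst (stake i fib_word)) @ [LA]"
  have len: "length ?xs = j"
    by (simp add: length_fib_subst_concat j_def)
  have split: "fib_word = ?xs @- LB ## fib_subst_word (sdrop (Suc i) fib_word)"
    using fib_word_split[of i] assms(1) by simp
  show "fib_word !! j = LB"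
    unfolding len[symmetric] by (subst split) (simp del: shift_append length_append)
  have "stake j fib_word = ?xs"
    by (subst split) (simp add: stake_shift len del: shift_append length_append take_append)
  then show "count_list (stake j fib_word) LB = count_list (stake i fib_word) LA"
    by (simp add: count_LB_fib_subst_concat)
qed

lemma infinite_fib_word_LA: "infinite {i. fib_word !! i = LA}"
  unfolding infinite_nat_iff_unbounded_le
  using snth_fib_word_LA le_add1 by blast

lemma infinite_fib_word: "infinite {i. fib_word !! i = x}"
proof (cases x)
  case LB
  have "\<exists>j\<ge>m. fib_word !! j = LB" for m
  proof -
    obtain i where "i \<ge> m" "fib_word !! i = LA"
      using infinite_fib_word_LA by (auto simp: infinite_nat_iff_unbounded_le)
    then show ?thesis using fib_word_LB_of_LA(1)[of i]
      by (intro exI[of _ "Suc (i + count_list (stake i fib_word) LA)"]) simp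
  qed
  then show ?thesis using LB by (simp add: infinite_nat_iff_unbounded_le)
qed (use infinite_fib_word_LA in simp)

lemma pos_LB_fib_word:
  assumes "n \<ge> 1"
  shows "pos LB fib_word n = pos LA fib_word n + n"
proof (rule pos_eqI)
  let ?i = "pos LA fib_word n"
  note a = pos_properties[OF infinite_fib_word[of LA] assms]
  \<comment> \<open>\<open>n\<close> also counts the \<open>LA\<close> at \<open>?i\<close> itself,
    which accounts for the \<open>Suc\<close>.\<close>
  have eq: "?i + n = Suc (?i + count_list (stake ?i fib_word) LA)"
    using a(2) by simp
  show "fib_word !! (?i + n) = LB"
    unfolding eq by (rule fib_word_LB_of_LA(1)[OF a(1)])
  show "Suc (count_list (stake (?i + n) fib_word) LB) = n"
    unfolding eq fib_word_LB_of_LA(2)[OF a(1)] by (rule a(2))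
qed (rule infinite_fib_word)

text \<open>Invariant of the deletions: \<open>w\<close> is \<open>s\<close> with its first
  \<open>m\<close> letters replaced by \<open>u\<close>, and \<open>c y\<close> counts the letters
  \<open>y\<close> lost. Lengthening both prefixes by \<open>Suc n\<close> letters covers the
  deleted position \<open>n\<close>, whether it lies in \<open>u\<close> or beyond.\<close>

lemma delete_first_shift_sdrop:
  assumes "w = u @- sdrop m s" "\<And>y. count_list (stake m s) y = count_list u y + c y"
    and "infinite {i. s !! i = x}"
  shows "\<exists>u' m'. delete_first x w = u' @- sdrop m' s \<and>
    (\<forall>y. count_list (stake m' s) y = count_list u' y + (c(x := Suc (c x))) y)"
proof -
  obtain i where "i \<ge> m" "s !! i = x"
    using assms(3) by (auto simp: infinite_nat_iff_unbounded_le)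
  then have "w !! (length u + (i - m)) = x"
    by (simp add: assms(1) sdrop_snth)
  then have ex: "\<exists>n. w !! n = x" by blast
  define n where "n = (LEAST n. w !! n = x)"
  have n: "w !! n = x" unfolding n_def using ex by (rule LeastI_ex)
  have del: "delete_first x w = stake n w @- sdrop (Suc n) w"
    using ex by (auto simp: delete_first_def n_def sset_range Let_def)
  let ?v = "stake (length u) (sdrop (Suc n) w)"
  have drop: "sdrop (length u) (sdrop (Suc n) w) = sdrop (m + Suc n) s"
  proof -
    have "sdrop (length u) (sdrop (Suc n) w) = sdrop (length u + Suc n) w"
      by (simp add: add.commute del: sdrop.simps)
    then show ?thesis by (simp add: assms(1) sdrop_shift del: sdrop.simps)
  qed
  have "delete_first x w = (stake n w @ ?v) @- sdrop (m + Suc n) s"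
    unfolding del shift_append drop[symmetric] stake_sdrop ..
  moreover have "count_list (stake (m + Suc n) s) y =
      count_list (stake n w @ ?v) y + (c(x := Suc (c x))) y" for y
  proof -
    \<comment> \<open>One prefix of \<open>w\<close> is read in two ways: around the deleted
      \<open>x\<close>, and as \<open>u\<close> followed by a block of \<open>s\<close>.\<close>
    have "stake n w @ x # ?v = stake (Suc n + length u) w"
      using n stake_add[of "Suc n" w "length u"] by (simp add: stake_Suc[of n] del: stake.simps sdrop.simps stake_add)
    also have "\<dots> = u @ stake (Suc n) (sdrop m s)"
      by (simp add: assms(1) stake_shift del: stake.simps)
    finally have "count_list (stake n w @ x # ?v) y = count_list (u @ stake (Suc n) (sdrop m s)) y"
      by simp
    moreover have "count_list (stake (m + Suc n) s) y =
        count_list (stake m s) y + count_list (stake (Suc n) (sdrop m s)) y"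
      by (simp only: count_list_append flip: stake_add)
    ultimately show ?thesis using assms(2)[of y]
      by (auto simp del: stake.simps sdrop.simps add_Suc_right split: if_splits)
  qed
  ultimately show ?thesis by blast
qed

lemma del_ab_funpow_fib_word:
  "\<exists>u m. (del_ab ^^ k) fib_word = u @- sdrop m fib_word \<and>
     (\<forall>y. count_list (stake m fib_word) y = count_list u y + k)"
proof (induction k)
  case 0
  show ?case by (rule exI[of _ "[]"], rule exI[of _ 0]) simp
next
  case (Suc k)
  then obtain u m where "(del_ab ^^ k) fib_word = u @- sdrop m fib_word"
    "\<And>y. count_list (stake m fib_word) y = count_list u y + (\<lambda>_. k) y" by auto
  from delete_first_shift_sdrop[OF this infinite_fib_word[of LA]]
  obtain u1 m1 where
    "delete_first LA ((del_ab ^^ k) fib_word) = u1 @- sdrop m1 fib_word"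
    "\<And>y. count_list (stake m1 fib_word) y = count_list u1 y + ((\<lambda>_. k)(LA := Suc k)) y"
    by blast
  from delete_first_shift_sdrop[OF this infinite_fib_word[of LB]]
  obtain u2 m2 where u2:
    "(del_ab ^^ Suc k) fib_word = u2 @- sdrop m2 fib_word"
    "\<And>y. count_list (stake m2 fib_word) y =
       count_list u2 y + ((\<lambda>_. k)(LA := Suc k, LB := Suc k)) y"
    by (auto simp: del_ab_def)
  have "((\<lambda>_. k)(LA := Suc k, LB := Suc k)) y = Suc k" for y
    by (cases y) auto
  then show ?case using u2 by metis
qed

text \<open>With \<open>k\<close> occurrences lost before the common tail, ordinals there drop by
  \<open>k\<close>. The shift of positions is written additively to avoid truncated
  subtraction.\<close>

lemma pos_shift_sdrop:
  assumes "infinite {i. s !! i = x}" "count_list (stake m s) x = count_list u x + k" "n > m"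
  shows "pos x (u @- sdrop m s) n + m = pos x s (n + k) + length u"
proof -
  let ?i = "pos x s (n + k)" and ?w = "u @- sdrop m s"
  have i: "s !! ?i = x" "Suc (count_list (stake ?i s) x) = n + k" "n + k \<le> Suc ?i"
    using pos_properties[OF assms(1), of "n + k"] assms(3) by auto
  \<comment> \<open>The occurrence numbered \<open>n + k\<close> has position at least
    \<open>n + k - 1\<close>, so \<open>n > m\<close> places it in the common tail.\<close>
  then obtain d where d: "?i = m + d" using assms(3) le_Suc_ex[of m ?i] by auto
  have snth: "?w !! (length u + j) = s !! (m + j)" for j
    by (simp add: sdrop_snth)
  have "pos x ?w n = length u + d"
  proof (rule pos_eqI)
    show "?w !! (length u + d) = x" using i d snth by simp
    have "count_list (stake (length u + d) ?w) x = count_list u x + count_list (stake d (sdrop m s)) x"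
      by (simp add: stake_shift)
    moreover have "count_list (stake ?i s) x =
        count_list (stake m s) x + count_list (stake d (sdrop m s)) x"
      by (simp add: d flip: stake_add)
    ultimately show "Suc (count_list (stake (length u + d) ?w) x) = n"
      using i assms(2) by simp
    show "infinite {j. ?w !! j = x}"
      unfolding infinite_nat_iff_unbounded_le
    proof
      fix l
      obtain j where "j \<ge> m + l" "s !! j = x"
        using assms(1) by (auto simp: infinite_nat_iff_unbounded_le)
      then show "\<exists>j\<ge>l. j \<in> {j. ?w !! j = x}"
        using snth[of "j - m"] by (intro exI[of _ "length u + (j - m)"]) simp
    qed
  qed
  then show ?thesis using d by simp
qed

theorem theorem4p8:
  fixes k :: nat
  assumes "k \<ge> 1"
  shows "\<exists>N::nat. \<forall>n>N. ab_diff ((del_ab ^^ k) fib_word) n = int n + int k"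
proof -
  obtain u m where w: "(del_ab ^^ k) fib_word = u @- sdrop m fib_word"
    and c: "\<And>y. count_list (stake m fib_word) y = count_list u y + k"
    using del_ab_funpow_fib_word by blast
  \<comment> \<open>The same \<open>u\<close> and \<open>m\<close> serve both letters, so the shift
    cancels in the difference and \<open>m\<close> can be taken as \<open>N\<close>.\<close>
  have "ab_diff ((del_ab ^^ k) fib_word) n = int n + int k" if "n > m" for n
  proof -
    have "pos x (u @- sdrop m fib_word) n + m = pos x fib_word (n + k) + length u" for x
      by (rule pos_shift_sdrop[OF infinite_fib_word c that])
    from this[of LA] this[of LB] show ?thesis
      using pos_LB_fib_word[of "n + k"] that by (simp add: ab_diff_def w)
  qed
  then show ?thesis by blast
qed

end
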